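(* Let $d\ge 1$ and let $\mathbb{T}=(T_{ij})$ be a $d\times d$ operator matrix where $T_{ij}\in\mathcal{B}_A(\mathcal{H})$ for all $i,j\in\{1,\dots,d\}$, regarded as an operator on $\mathbb{H}=\oplus_{i=1}^d\mathcal{H}$. Then $$\omega_{\mathbb{A}}(\mathbb{T})\leq \frac{1}{2}\sum_{i=1}^d\left(\|T_{ii}\|_A+\sqrt{\left\|T_{ii}T_{ii}^{\sharp_A}+\sum_{j=1,\,j\neq i}^{d}T_{ij}T_{ij}^{\sharp_A}\right\|_A}\right).$$
   Context: $(\mathcal{H},\langle\cdot\mid\cdot\rangle)$ is a non-trivial complex Hilbert space, $\mathcal{B}(\mathcal{H})$ is the algebra of bounded linear operators on $\mathcal{H}$, and $A\in\mathcal{B}(\mathcal{H})$ is a fixed nonzero positive (semidefinite) operator. Put $\langle x\mid y\rangle_A=\langle Ax\mid y\rangle$ and $\|x\|_A=\langle x\mid x\rangle_A^{1/2}$. An operator $T\in\mathcal{B}(\mathcal{H})$ is $A$-bounded, written $T\in\mathcal{B}_{A^{1/2}}(\mathcal{H})$, if there is $\lambda>0$ with $\|Tx\|_A\le\lambda\|x\|_A$ for all $x\in\mathcal{H}$. For such $T$, $\|T\|_A=\sup\{\|Tx\|_A : x\in\mathcal{H},\ \|x\|_A=1\}$ and the $A$-numerical radius is $\omega_A(T)=\sup\{|\langle Tx\mid x\rangle_A| : x\in\mathcal{H},\ \|x\|_A=1\}$. $\mathcal{B}_A(\mathcal{H})$ is the set of $T\in\mathcal{B}(\mathcal{H})$ for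 which the equation $AX=T^*A$ has a solution $X\in\mathcal{B}(\mathcal{H})$ (equivalently $\mathcal{R}(T^*A)\subset\mathcal{R}(A)$, where $\mathcal{R}$ denotes range); one has $\mathcal{B}_A(\mathcal{H})\subseteq\mathcal{B}_{A^{1/2}}(\mathcal{H})$. For $T\in\mathcal{B}_A(\mathcal{H})$, $T^{\sharp_A}$ denotes the unique solution $X\in\mathcal{B}(\mathcal{H})$ of $AX=T^*A$ with $\mathcal{R}(X)\subseteq\overline{\mathcal{R}(A)}$. $\mathbb{H}=\oplus_{i=1}^d\mathcal{H}$ has the inner product $\langle x,y\rangle=\sum_{k=1}^d\langle x_k\mid y_k\rangle$, and $\mathbb{A}$ is the $d\times d$ diagonal operator matrix on $\mathbb{H}$ with every diagonal entry equal to $A$. $\omega_{\mathbb{A}}$ is the notion above with $(\mathbb{H},\mathbb{A})$ in place of $(\mathcal{H},A)$. *)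

theory Defs
  imports "HOL-Analysis.Analysis"
begin

(* The underlying real inner product is the real part of the complex one, so
   norm, metric and topology of a complex inner product space are those already
   provided by real_inner.  The complex inner product is linear in its first
   argument and conjugate-linear in its second. *)
class complex_inner = real_inner +
  fixes scaleC :: "complex \<Rightarrow> 'a \<Rightarrow> 'a"  (infixr "*\<^sub>C" 75)
    and cinner :: "'a \<Rightarrow> 'a \<Rightarrow> complex"
  assumes scaleC_add_right: "c *\<^sub>C (x + y) = c *\<^sub>C x + c *\<^sub>C y"
    and scaleC_add_left: "(b + c) *\<^sub>C x = b *\<^sub>C x + c *\<^sub>C x"
    and scaleC_scaleC: "b *\<^sub>C c *\<^sub>C x = (b * c) *\<^sub>C x"
    and scaleR_scaleC: "r *\<^sub>R x = complex_of_real r *\<^sub>C x"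
    and cinner_commute: "cinner x y = cnj (cinner y x)"
    and cinner_add_left: "cinner (x + y) z = cinner x z + cinner y z"
    and cinner_scaleC_left: "cinner (c *\<^sub>C x) y = c * cinner x y"
    and inner_eq_Re_cinner: "inner x y = Re (cinner x y)"

class complex_hilbert_space = complex_inner + complete_space

instantiation complex :: complex_hilbert_space
begin

definition scaleC_complex :: "complex \<Rightarrow> complex \<Rightarrow> complex"
  where "scaleC_complex c z = c * z"

definition cinner_complex :: "complex \<Rightarrow> complex \<Rightarrow> complex"
  where "cinner_complex z w = z * cnj w"

instance
  by standard
    (simp_all add: scaleC_complex_def cinner_complex_def algebra_simps inner_complex_def
      scaleR_conv_of_real)

end

(* The Hilbert space direct sum of finitely many copies of a Hilbert space,
   indexed by a finite type; the inherited inner product and norm on vec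
   are the corresponding (l2) ones. *)
instantiation vec :: (complex_inner, finite) complex_inner
begin

definition scaleC_vec :: "complex \<Rightarrow> 'a ^ 'b \<Rightarrow> 'a ^ 'b"
  where "scaleC_vec c x = (\<chi> i. c *\<^sub>C (x $ i))"

definition cinner_vec :: "'a ^ 'b \<Rightarrow> 'a ^ 'b \<Rightarrow> complex"
  where "cinner_vec x y = (\<Sum>i\<in>UNIV. cinner (x $ i) (y $ i))"

instance
proof
  fix x y :: "'a ^ 'b"
  show "cinner x y = cnj (cinner y x)"
    unfolding cinner_vec_def cnj_sum by (rule sum.cong[OF refl], rule cinner_commute)
qed (simp_all add: scaleC_vec_def cinner_vec_def vec_eq_iff inner_vec_def
    scaleC_add_right scaleC_add_left scaleC_scaleC scaleR_scaleC
    cinner_add_left cinner_scaleC_left inner_eq_Re_cinner sum.distrib sum_distrib_left)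

end

instance vec :: (complex_hilbert_space, finite) complex_hilbert_space ..

definition bounded_clinear :: "('a::complex_inner \<Rightarrow> 'b::complex_inner) \<Rightarrow> bool"
  where "bounded_clinear T \<longleftrightarrow> bounded_linear T \<and> (\<forall>c x. T (c *\<^sub>C x) = c *\<^sub>C T x)"

definition cadjoint :: "('a::complex_inner \<Rightarrow> 'a) \<Rightarrow> 'a \<Rightarrow> 'a"
  where "cadjoint T = (THE S. \<forall>x y. cinner (T x) y = cinner x (S y))"

definition positive_op :: "('a::complex_inner \<Rightarrow> 'a) \<Rightarrow> bool"
  where "positive_op A \<longleftrightarrow> bounded_clinear A \<and> (\<forall>x. cinner (A x) x \<in> \<real>\<^sub>\<ge>\<^sub>0)"

definition A_inner :: "('a::complex_inner \<Rightarrow> 'a) \<Rightarrow> 'a \<Rightarrow> 'a \<Rightarrow> complex"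
  where "A_inner A x y = cinner (A x) y"

(* For positive A the number A_inner A x x is a nonnegative real. *)
definition A_norm :: "('a::complex_inner \<Rightarrow> 'a) \<Rightarrow> 'a \<Rightarrow> real"
  where "A_norm A x = sqrt (Re (A_inner A x x))"

(* The following two suprema are meaningful for nonzero positive A and A-bounded T;
   otherwise the set may be empty or unbounded. *)
definition A_opnorm :: "('a::complex_inner \<Rightarrow> 'a) \<Rightarrow> ('a \<Rightarrow> 'a) \<Rightarrow> real"
  where "A_opnorm A T = Sup {A_norm A (T x) |x. A_norm A x = 1}"

definition A_numerical_radius :: "('a::complex_inner \<Rightarrow> 'a) \<Rightarrow> ('a \<Rightarrow> 'a) \<Rightarrow> real"
  where "A_numerical_radius A T = Sup {cmod (A_inner A (T x) x) |x. A_norm A x = 1}"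

definition A_adjointable :: "('a::complex_inner \<Rightarrow> 'a) \<Rightarrow> ('a \<Rightarrow> 'a) set"
  where "A_adjointable A =
    {T. bounded_clinear T \<and> (\<exists>X. bounded_clinear X \<and> A \<circ> X = cadjoint T \<circ> A)}"

definition A_adjoint :: "('a::complex_inner \<Rightarrow> 'a) \<Rightarrow> ('a \<Rightarrow> 'a) \<Rightarrow> 'a \<Rightarrow> 'a"
  where "A_adjoint A T = (THE X. bounded_clinear X \<and> A \<circ> X = cadjoint T \<circ> A
    \<and> range X \<subseteq> closure (range A))"

definition op_matrix :: "('d \<Rightarrow> 'd \<Rightarrow> 'a \<Rightarrow> 'a) \<Rightarrow> 'a::complex_inner ^ 'd::finite \<Rightarrow> 'a ^ 'd"
  where "op_matrix T x = (\<chi> i. \<Sum>j\<in>UNIV. T i j (x $ j))"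

definition diag_op :: "('a \<Rightarrow> 'a) \<Rightarrow> 'a::complex_inner ^ 'd::finite \<Rightarrow> 'a ^ 'd"
  where "diag_op A = op_matrix (\<lambda>i j. if i = j then A else (\<lambda>x. 0))"

end

theory Submission
  imports Defs
begin

text \<open>
  Write \<open>\<langle>x | y\<rangle>\<close> for the semi-inner product of \<open>A\<close> and \<open>\<parallel>x\<parallel>\<close> for its seminorm. The quadratic form of the
  operator matrix splits into its rows, \<open>\<Sum>i. \<langle>\<Sum>j. T i j (x j) | x i\<rangle>\<close>, and for a unit vector \<open>x\<close> each
  row is bounded separately (\<open>row_numerical_radius_bound\<close>). With \<open>z j\<close> the image of \<open>x i\<close> under the adjoint
  of \<open>T i j\<close>, row \<open>i\<close> is \<open>\<Sum>j. \<langle>x j | z j\<rangle>\<close>. By Cauchy--Schwarz it is at most \<open>t * p + s * w\<close>, where \<open>t\<close> and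
  \<open>p\<close> are the lengths of \<open>x i\<close> and \<open>z i\<close>, and \<open>s\<close> and \<open>w\<close> are the lengths of the vectors formed by the
  other components. Here \<open>t\<^sup>2 + s\<^sup>2 = 1\<close>, \<open>p \<le> a * t\<close> with \<open>a\<close> the seminorm of \<open>T i i\<close>, and
  \<open>p\<^sup>2 + w\<^sup>2 \<le> \<kappa> * t\<^sup>2\<close> with \<open>\<kappa>\<close> the seminorm of the sum over \<open>j\<close> of \<open>T i j\<close> times its adjoint. Maximising
  over the angle with cosine \<open>t\<close> gives \<open>(a + sqrt \<kappa>) / 2\<close> (\<open>double_angle_bound\<close>).

  Two facts make the objects in the statement meaningful. The definite descriptions denoting the two
  kinds of adjoint exist: this rests on orthogonal projection onto closed subspaces, from which Riesz
  representation follows (\<open>cadjoint_works\<close>, \<open>A_adjoint_works\<close>). And the suprema defining operator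
  seminorms are finite: an operator with an adjoint for \<open>\<langle>_ | _\<rangle>\<close> is bounded for the seminorm, which reduces
  to symmetric operators and there follows from the growth of their iterates
  (\<open>symmetric_imp_semi_bounded\<close>).
\<close>

section \<open>Orthogonal projections and adjoints in a Hilbert space\<close>

lemma cinner_add_right: "cinner x (y + z) = cinner x y + cinner (x::'a::complex_inner) z"
  by (metis cinner_add_left cinner_commute complex_cnj_add)

lemma cinner_scaleC_right: "cinner x (c *\<^sub>C y) = cnj c * cinner (x::'a::complex_inner) y"
  by (metis cinner_commute cinner_scaleC_left complex_cnj_mult)

lemma cinner_zero_left [simp]: "cinner 0 (y::'a::complex_inner) = 0"
  using cinner_add_left[of 0 0 y] by simp

lemma cinner_zero_right [simp]: "cinner (y::'a::complex_inner) 0 = 0"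
  using cinner_add_right[of y 0 0] by simp

lemma cinner_diff_left: "cinner (x - y) z = cinner x z - cinner y (z::'a::complex_inner)"
  using cinner_add_left[of "x - y" y z] by (simp add: algebra_simps)

lemma complex_eq_if_Re_mult_i:
  assumes "Re z = Re w" "Re (\<i> * z) = Re (\<i> * w)"
  shows "z = w"
  using assms by (simp add: complex_eq_iff)

lemma cinner_right_cancel:
  assumes "\<And>x::'a::complex_inner. cinner x y = cinner x z"
  shows "y = z"
proof -
  have "inner (y - z) y = inner (y - z) z"
    using assms by (simp add: inner_eq_Re_cinner)
  then have "inner (y - z) (y - z) = 0" by (simp add: inner_diff_right)
  then show ?thesis by simp
qed

lemma cinner_left_cancel:
  assumes "\<And>x::'a::complex_inner. cinner y x = cinner z x"
  shows "y = z"
  by (rule cinner_right_cancel) (metis assms cinner_commute)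

text \<open>Completeness replaces compactness: the parallelogram law makes any minimising sequence Cauchy.\<close>

lemma subspace_closest_point:
  fixes M :: "'a::{real_inner, complete_space} set"
  assumes sub: "subspace M" and cl: "closed M"
  obtains p where "p \<in> M" "\<And>m. m \<in> M \<Longrightarrow> norm (x - p) \<le> norm (x - m)"
proof -
  define V where "V = (\<lambda>m. (norm (x - m))\<^sup>2) ` M"
  define D where "D = Inf V"
  have ne: "V \<noteq> {}" using subspace_0[OF sub] by (auto simp: V_def)
  have bb: "bdd_below V" by (rule bdd_belowI[of _ 0]) (auto simp: V_def)
  have D: "D \<le> (norm (x - m))\<^sup>2" if "m \<in> M" for m
    unfolding D_def by (rule cInf_lower[OF _ bb]) (use that in \<open>auto simp: V_def\<close>)
  have "\<exists>m\<in>M. (norm (x - m))\<^sup>2 < D + 1 / real (Suc n)" for n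
    using cInf_lessD[OF ne, of "D + 1 / real (Suc n)"] by (auto simp: D_def V_def)
  then obtain m where m: "\<And>n. m n \<in> M" "\<And>n. (norm (x - m n))\<^sup>2 < D + 1 / real (Suc n)"
    by metis
  \<comment> \<open>Parallelogram law: the midpoint of two near-minimisers also lies in the subspace.\<close>
  have dist: "(norm (m i - m j))\<^sup>2 \<le> 2 / real (Suc i) + 2 / real (Suc j)" for i j
  proof -
    let ?c = "(1/2) *\<^sub>R (m i + m j)"
    have "?c \<in> M" using sub m by (intro subspace_scale subspace_add)
    then have "D \<le> (norm (x - ?c))\<^sup>2" by (rule D)
    moreover have "(norm (m i - m j))\<^sup>2
      = 2 * (norm (x - m i))\<^sup>2 + 2 * (norm (x - m j))\<^sup>2 - 4 * (norm (x - ?c))\<^sup>2"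
      by (simp add: power2_norm_eq_inner inner_commute algebra_simps)
    ultimately show ?thesis using m(2)[of i] m(2)[of j] by simp
  qed
  have "Cauchy m"
  proof (rule metric_CauchyI)
    fix e :: real assume e: "0 < e"
    obtain N where N: "4 / e\<^sup>2 < real N" using reals_Archimedean2 by blast
    show "\<exists>N. \<forall>i\<ge>N. \<forall>j\<ge>N. dist (m i) (m j) < e"
    proof (intro exI allI impI)
      fix i j assume ij: "N \<le> i" "N \<le> j"
      have *: "2 / real (Suc k) < e\<^sup>2 / 2" if "N \<le> k" for k
      proof -
        have "4 / e\<^sup>2 < real (Suc k)" using N that by linarith
        then show ?thesis using e by (simp add: field_simps)
      qed
      have "(norm (m i - m j))\<^sup>2 < e\<^sup>2"
        using dist[of i j] *[OF ij(1)] *[OF ij(2)] by linarith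
      then show "dist (m i) (m j) < e"
        using e by (simp add: dist_norm power_less_imp_less_base)
    qed
  qed
  then obtain p where p: "m \<longlonglongrightarrow> p" using Cauchy_convergent convergent_def by blast
  have pM: "p \<in> M" using closed_sequentially[OF cl m(1) p] .
  have "(norm (x - p))\<^sup>2 \<le> D"
  proof (rule LIMSEQ_le)
    show "(\<lambda>n. (norm (x - m n))\<^sup>2) \<longlonglongrightarrow> (norm (x - p))\<^sup>2" by (intro tendsto_intros p)
    have "(\<lambda>n. D + 1 / real (Suc n)) \<longlonglongrightarrow> D + 0"
      by (intro tendsto_intros LIMSEQ_Suc lim_1_over_n)
    then show "(\<lambda>n. D + 1 / real (Suc n)) \<longlonglongrightarrow> D" by simp
    show "\<exists>N. \<forall>n\<ge>N. (norm (x - m n))\<^sup>2 \<le> D + 1 / real (Suc n)"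
      using m(2) less_imp_le by blast
  qed
  then have "norm (x - p) \<le> norm (x - y)" if "y \<in> M" for y
    using D[OF that] power2_le_imp_le order_trans norm_ge_zero by metis
  with pM show ?thesis by (rule that)
qed

text \<open>The residual at a closest point is orthogonal to the subspace: moving the point along \<open>m\<close> by the
optimal step would otherwise decrease the distance.\<close>

lemma subspace_orthogonal_decomposition:
  fixes M :: "'a::{real_inner, complete_space} set"
  assumes sub: "subspace M" and cl: "closed M"
  obtains p where "p \<in> M" "\<And>m. m \<in> M \<Longrightarrow> inner (x - p) m = 0"
proof -
  obtain p where p: "p \<in> M" and min: "\<And>m. m \<in> M \<Longrightarrow> norm (x - p) \<le> norm (x - m)"
    using subspace_closest_point[OF assms] by metis
  have "inner (x - p) m = 0" if m: "m \<in> M" for m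
  proof (rule ccontr)
    let ?u = "x - p"
    assume ne: "inner ?u m \<noteq> 0"
    then have "m \<noteq> 0" by auto
    define t where "t = inner ?u m / inner m m"
    have mm: "inner m m > 0" using \<open>m \<noteq> 0\<close> by simp
    have "p + t *\<^sub>R m \<in> M" using sub p m by (intro subspace_scale subspace_add)
    from min[OF this] have "(norm ?u)\<^sup>2 \<le> (norm (?u - t *\<^sub>R m))\<^sup>2"
      by (simp add: algebra_simps)
    also have "\<dots> = (norm ?u)\<^sup>2 - 2 * t * inner ?u m + t * (t * inner m m)"
      by (simp add: power2_norm_eq_inner inner_diff_left inner_diff_right inner_commute)
    also have "t * inner m m = inner ?u m" using mm by (simp add: t_def)
    finally have "t * inner ?u m \<le> 0" by simp
    moreover have "t * inner ?u m > 0"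
    proof -
      have "t * inner ?u m = (inner ?u m)\<^sup>2 / inner m m" by (simp add: t_def power2_eq_square)
      then show ?thesis using ne mm by simp
    qed
    ultimately show False by simp
  qed
  with p show ?thesis by (rule that)
qed

text \<open>The representing vector is a multiple of the residual \<open>u\<close> of any vector outside the kernel of \<open>f\<close>:
the kernel has codimension one, so it and \<open>u\<close> span the whole space.\<close>

lemma Riesz_representation:
  fixes f :: "'a::{real_inner, complete_space} \<Rightarrow> real"
  assumes f: "bounded_linear f"
  obtains z where "\<And>x. f x = inner x z"
proof (cases "\<forall>x. f x = 0")
  case True
  then show ?thesis using that[of 0] by simp
next
  case False
  interpret bounded_linear f by (rule f)
  obtain x0 where x0: "f x0 \<noteq> 0" using False by auto
  have "closed (f -` {0})" by (intro closed_vimage continuous_on continuous_on_id) auto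
  then have cl: "closed {x. f x = 0}" by (simp add: vimage_def)
  have "subspace {x. f x = 0}" by (auto simp: subspace_def add scale zero)
  from subspace_orthogonal_decomposition[OF this cl] obtain p
    where p: "f p = 0" "\<And>m. f m = 0 \<Longrightarrow> inner (x0 - p) m = 0"
    by (metis (mono_tags, lifting) mem_Collect_eq)
  define u where "u = x0 - p"
  have fu: "f u \<noteq> 0" using x0 p by (simp add: u_def diff)
  then have uu: "inner u u \<noteq> 0" using zero by auto
  have "f x = inner x ((f u / inner u u) *\<^sub>R u)" for x
  proof -
    have "f (x - (f x / f u) *\<^sub>R u) = 0" using fu by (simp add: diff scale)
    then have "inner u (x - (f x / f u) *\<^sub>R u) = 0" using p(2) u_def by simp
    then have "inner x u = f x / f u * inner u u"
      by (simp add: inner_diff_right inner_commute)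
    then show ?thesis using fu uu by simp
  qed
  then show ?thesis by (rule that)
qed

text \<open>The adjoint is a definite description, so it says nothing until its existence is known. The real
Riesz theorem suffices for that: replacing \<open>x\<close> by \<open>\<i> *\<^sub>C x\<close> turns an identity of real parts into one of
imaginary parts.\<close>

lemma cadjoint_works:
  fixes T :: "'a::complex_hilbert_space \<Rightarrow> 'a"
  assumes T: "bounded_clinear T"
  shows "cinner (T x) y = cinner x (cadjoint T y)"
proof -
  have lin: "bounded_linear T" and sc: "T (c *\<^sub>C x) = c *\<^sub>C T x" for c x
    using T by (auto simp: bounded_clinear_def)
  have "\<exists>z. \<forall>x. inner (T x) y = inner x z" for y
    using Riesz_representation[OF bounded_linear_compose[OF bounded_linear_inner_left lin]]
    by metis
  then obtain S where S: "\<And>x y. inner (T x) y = inner x (S y)" by metis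
  have S': "cinner (T x) y = cinner x (S y)" for x y
  proof (rule complex_eq_if_Re_mult_i)
    show "Re (cinner (T x) y) = Re (cinner x (S y))"
      using S by (simp add: inner_eq_Re_cinner)
    show "Re (\<i> * cinner (T x) y) = Re (\<i> * cinner x (S y))"
      using S[of "\<i> *\<^sub>C x" y] unfolding sc inner_eq_Re_cinner cinner_scaleC_left .
  qed
  have "\<exists>!S. \<forall>x y. cinner (T x) y = cinner x (S y)"
  proof (rule ex1I[of _ S])
    fix R assume "\<forall>x y. cinner (T x) y = cinner x (R y)"
    then have "\<And>x y. cinner x (R y) = cinner x (S y)" using S' by simp
    then have "R y = S y" for y by (rule cinner_right_cancel)
    then show "R = S" by (rule ext)
  qed (simp add: S')
  from theI'[OF this, folded cadjoint_def] show ?thesis by blast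
qed

text \<open>Characterising the projection by orthogonality makes it unique, and uniqueness gives linearity; a
subspace closed under complex scalars makes orthogonality for the real and the complex inner product
the same.\<close>

lemma orthogonal_projection_exists:
  fixes M :: "'a::complex_hilbert_space set"
  assumes cl: "closed M" and zero: "0 \<in> M"
    and add: "\<And>x y. x \<in> M \<Longrightarrow> y \<in> M \<Longrightarrow> x + y \<in> M"
    and scale: "\<And>c x. x \<in> M \<Longrightarrow> c *\<^sub>C x \<in> M"
  shows "\<exists>P. bounded_clinear P \<and> (\<forall>x. P x \<in> M) \<and> (\<forall>x. \<forall>m\<in>M. cinner (x - P x) m = 0)"
proof -
  have sub: "subspace M" using zero add scale by (auto simp: subspace_def scaleR_scaleC)
  have "\<exists>p. p \<in> M \<and> (\<forall>m\<in>M. inner (x - p) m = 0)" for x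
    by (rule subspace_orthogonal_decomposition[OF sub cl, of x]) blast
  then obtain P where PM: "\<And>x. P x \<in> M"
    and ort: "\<And>x m. m \<in> M \<Longrightarrow> inner (x - P x) m = 0"
    by metis
  have unique: "P x = p" if p: "p \<in> M" "\<And>m. m \<in> M \<Longrightarrow> inner (x - p) m = 0" for x p
  proof -
    have "P x - p \<in> M" using PM p(1) sub by (intro subspace_diff)
    then have "inner (x - p) (P x - p) - inner (x - P x) (P x - p) = 0"
      using p(2) ort by simp
    then have "inner (P x - p) (P x - p) = 0" by (simp add: inner_diff_left)
    then show ?thesis by simp
  qed
  have cort: "cinner (x - P x) m = 0" if m: "m \<in> M" for x m
  proof -
    have "Re (cinner (x - P x) m) = 0" using ort[OF m] by (simp add: inner_eq_Re_cinner)
    moreover have "Re (cinner (x - P x) (\<i> *\<^sub>C m)) = 0"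
      using ort[OF scale[OF m]] by (simp add: inner_eq_Re_cinner)
    ultimately show ?thesis by (simp add: cinner_scaleC_right complex_eq_iff)
  qed
  have Padd: "P (x + y) = P x + P y" for x y
  proof (rule unique)
    show "P x + P y \<in> M" using PM add by simp
    show "inner (x + y - (P x + P y)) m = 0" if "m \<in> M" for m
      using ort[OF that, of x] ort[OF that, of y] by (simp add: inner_diff_left inner_add_left)
  qed
  have Psc: "P (c *\<^sub>C x) = c *\<^sub>C P x" for c x
  proof (rule unique)
    show "c *\<^sub>C P x \<in> M" using PM scale by simp
    show "inner (c *\<^sub>C x - c *\<^sub>C P x) m = 0" if "m \<in> M" for m
      using cort[OF that, of x]
      by (simp add: inner_eq_Re_cinner cinner_diff_left cinner_scaleC_left)
  qed
  have bound: "norm (P x) \<le> norm x * 1" for x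
  proof -
    have "inner (x - P x) (P x) = 0" using ort PM by blast
    then have "(norm (P x))\<^sup>2 = inner x (P x)"
      by (simp add: inner_diff_left power2_norm_eq_inner)
    also have "\<dots> \<le> norm x * norm (P x)" by (rule norm_cauchy_schwarz)
    finally show ?thesis
      by (cases "norm (P x) = 0") (simp_all add: power2_eq_square)
  qed
  have "bounded_linear P"
    by (rule bounded_linear_intro[where K = 1]) (simp_all add: Padd Psc scaleR_scaleC bound[simplified])
  then have "bounded_clinear P" using Psc by (simp add: bounded_clinear_def)
  then show ?thesis using PM cort by (intro exI[of _ P]) simp
qed

lemma norm_scaleC: "norm (c *\<^sub>C x) = cmod c * norm (x::'a::complex_inner)"
proof -
  have "inner (c *\<^sub>C x) (c *\<^sub>C x) = Re (c * cnj c * cinner x x)"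
    by (simp add: inner_eq_Re_cinner cinner_scaleC_left cinner_scaleC_right algebra_simps)
  also have "\<dots> = (cmod c)\<^sup>2 * inner x x"
    by (simp add: complex_norm_square[symmetric] inner_eq_Re_cinner del: of_real_power)
  finally have "(norm (c *\<^sub>C x))\<^sup>2 = (cmod c * norm x)\<^sup>2"
    by (simp add: power2_norm_eq_inner power_mult_distrib)
  then show ?thesis by simp
qed

lemma bounded_linear_scaleC: "bounded_linear (\<lambda>x::'a::complex_inner. c *\<^sub>C x)"
  by (rule bounded_linear_intro[where K = "cmod c"])
    (simp_all add: scaleC_add_right scaleR_scaleC scaleC_scaleC norm_scaleC mult.commute)

lemma bounded_clinear_compose:
  "bounded_clinear S \<Longrightarrow> bounded_clinear T \<Longrightarrow> bounded_clinear (\<lambda>x. S (T x))"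
  by (simp add: bounded_clinear_def bounded_linear_compose)

lemma bounded_clinear_add:
  assumes "bounded_clinear T" shows "T (x + y) = T x + T y"
  using assms by (simp add: bounded_clinear_def bounded_linear.linear linear_add)

lemma bounded_clinear_diff:
  assumes "bounded_clinear T" shows "T (x - y) = T x - T y"
  using assms by (simp add: bounded_clinear_def bounded_linear.linear linear_diff)

lemma bounded_clinear_scaleC:
  "bounded_clinear T \<Longrightarrow> T (c *\<^sub>C x) = c *\<^sub>C T x"
  by (simp add: bounded_clinear_def)

lemma bounded_clinear_sum:
  assumes "\<And>i. i \<in> I \<Longrightarrow> bounded_clinear (T i)"
  shows "bounded_clinear (\<lambda>x. \<Sum>i\<in>I. T i x)"
  unfolding bounded_clinear_def
proof (intro conjI allI)
  show "bounded_linear (\<lambda>x. \<Sum>i\<in>I. T i x)"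
    using assms by (intro bounded_linear_sum) (auto simp: bounded_clinear_def)
  show "(\<Sum>i\<in>I. T i (c *\<^sub>C x)) = c *\<^sub>C (\<Sum>i\<in>I. T i x)" for c x
    using assms
    by (simp add: bounded_clinear_scaleC linear_sum[OF bounded_linear.linear[OF bounded_linear_scaleC]])
qed

section \<open>The semi-inner product of a positive operator\<close>

locale positive_operator =
  fixes A :: "'h::complex_inner \<Rightarrow> 'h"
  assumes positive: "positive_op A"
begin

abbreviation semi_inner :: "'h \<Rightarrow> 'h \<Rightarrow> complex" ("\<langle>_ | _\<rangle>")
  where "\<langle>x | y\<rangle> \<equiv> A_inner A x y"

abbreviation semi_norm :: "'h \<Rightarrow> real" ("\<parallel>_\<parallel>")
  where "\<parallel>x\<parallel> \<equiv> A_norm A x"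

lemma bounded_clinear: "bounded_clinear A"
  using positive by (simp add: positive_op_def)

lemma seminorm_nonneg [simp]: "0 \<le> \<parallel>x\<parallel>"
  using positive by (simp add: A_norm_def A_inner_def positive_op_def complex_nonneg_Reals_iff)

lemma semi_inner_add_left: "\<langle>x + y | z\<rangle> = \<langle>x | z\<rangle> + \<langle>y | z\<rangle>"
  by (simp add: A_inner_def bounded_clinear_add[OF bounded_clinear] cinner_add_left)

lemma semi_inner_add_right: "\<langle>x | y + z\<rangle> = \<langle>x | y\<rangle> + \<langle>x | z\<rangle>"
  by (simp add: A_inner_def cinner_add_right)

lemma semi_inner_scaleC_left: "\<langle>c *\<^sub>C x | y\<rangle> = c * \<langle>x | y\<rangle>"
  by (simp add: A_inner_def bounded_clinear_scaleC[OF bounded_clinear] cinner_scaleC_left)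

lemma semi_inner_scaleC_right: "\<langle>x | c *\<^sub>C y\<rangle> = cnj c * \<langle>x | y\<rangle>"
  by (simp add: A_inner_def cinner_scaleC_right)

lemma semi_inner_sum_left: "\<langle>sum f I | y\<rangle> = (\<Sum>i\<in>I. \<langle>f i | y\<rangle>)"
proof -
  have "\<langle>0 | y\<rangle> = 0" using semi_inner_add_left[of 0 0 y] by simp
  then show ?thesis
    by (induction I rule: infinite_finite_induct) (auto simp: semi_inner_add_left)
qed

lemma semi_inner_nonneg: "0 \<le> Re \<langle>x | x\<rangle>" and Im_semi_inner_self: "Im \<langle>x | x\<rangle> = 0"
  using positive by (auto simp: positive_op_def A_inner_def complex_nonneg_Reals_iff)

lemma seminorm_power2: "\<parallel>x\<parallel>\<^sup>2 = Re \<langle>x | x\<rangle>"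
  by (simp add: A_norm_def semi_inner_nonneg)

lemma semi_inner_self: "\<langle>x | x\<rangle> = complex_of_real (\<parallel>x\<parallel>\<^sup>2)"
  by (simp add: complex_eq_iff seminorm_power2 Im_semi_inner_self del: of_real_power)

text \<open>Polarisation: the values on the diagonal are real, in particular at \<open>x + y\<close> and \<open>x + \<i> *\<^sub>C y\<close>.\<close>

lemma semi_inner_commute: "\<langle>x | y\<rangle> = cnj \<langle>y | x\<rangle>"
proof -
  have "Im \<langle>x + y | x + y\<rangle> = 0" "Im \<langle>x + \<i> *\<^sub>C y | x + \<i> *\<^sub>C y\<rangle> = 0"
    by (rule Im_semi_inner_self)+
  then show ?thesis
    using Im_semi_inner_self[of x] Im_semi_inner_self[of y]
    by (simp add: semi_inner_add_left semi_inner_add_right semi_inner_scaleC_left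
        semi_inner_scaleC_right complex_eq_iff)
qed

lemma self_adjoint: "cinner (A x) y = cinner x (A y)"
  using semi_inner_commute[of x y] cinner_commute[of x "A y"] by (simp add: A_inner_def)

lemma seminorm_scaleC: "\<parallel>c *\<^sub>C x\<parallel> = cmod c * \<parallel>x\<parallel>"
proof -
  have "complex_of_real (\<parallel>c *\<^sub>C x\<parallel>\<^sup>2) = c * cnj c * \<langle>x | x\<rangle>"
    unfolding semi_inner_self[symmetric]
    by (simp add: semi_inner_scaleC_left semi_inner_scaleC_right)
  also have "\<dots> = complex_of_real ((cmod c * \<parallel>x\<parallel>)\<^sup>2)"
    by (simp add: semi_inner_self complex_norm_square[symmetric] power_mult_distrib)
  finally have "\<parallel>c *\<^sub>C x\<parallel>\<^sup>2 = (cmod c * \<parallel>x\<parallel>)\<^sup>2" using of_real_eq_iff by blast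
  then show ?thesis by (simp add: power2_eq_iff_nonneg)
qed

text \<open>Nonnegativity of the form at \<open>x - t * \<langle>x | y\<rangle> *\<^sub>C y\<close> for real \<open>t\<close>. As the seminorm may vanish at
\<open>y \<noteq> 0\<close>, that case needs its own choice of \<open>t\<close>.\<close>

lemma semi_Cauchy_Schwarz: "cmod \<langle>x | y\<rangle> \<le> \<parallel>x\<parallel> * \<parallel>y\<parallel>"
proof -
  define b where "b = \<langle>x | y\<rangle>"
  have quadratic: "0 \<le> \<parallel>x\<parallel>\<^sup>2 - 2 * t * (cmod b)\<^sup>2 + t * (t * \<parallel>y\<parallel>\<^sup>2) * (cmod b)\<^sup>2" for t :: real
  proof -
    define c where "c = - (complex_of_real t * b)"
    have yx: "\<langle>y | x\<rangle> = cnj b" using semi_inner_commute[of y x] by (simp add: b_def)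
    have bb: "b * cnj b = complex_of_real ((cmod b)\<^sup>2)" by (rule complex_norm_square[symmetric])
    have "\<langle>x + c *\<^sub>C y | x + c *\<^sub>C y\<rangle>
      = \<langle>x | x\<rangle> + cnj c * b + c * cnj b + c * cnj c * \<langle>y | y\<rangle>"
      by (simp add: semi_inner_add_left semi_inner_add_right semi_inner_scaleC_left
          semi_inner_scaleC_right yx b_def[symmetric] algebra_simps)
    also have "\<dots> = \<langle>x | x\<rangle> - 2 * t * (b * cnj b) + t * t * (b * cnj b) * \<langle>y | y\<rangle>"
      by (simp add: c_def algebra_simps)
    also have "\<dots> = complex_of_real
      (\<parallel>x\<parallel>\<^sup>2 - 2 * t * (cmod b)\<^sup>2 + t * (t * \<parallel>y\<parallel>\<^sup>2) * (cmod b)\<^sup>2)"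
      unfolding bb semi_inner_self by (simp add: algebra_simps)
    finally show ?thesis using semi_inner_nonneg[of "x + c *\<^sub>C y"] by simp
  qed
  have "(cmod b)\<^sup>2 \<le> (\<parallel>x\<parallel> * \<parallel>y\<parallel>)\<^sup>2"
  proof (cases "\<parallel>y\<parallel> = 0")
    case True
    have "b = 0"
    proof (rule ccontr)
      assume "b \<noteq> 0"
      then show False
        \<comment> \<open>With a vanishing quadratic term, this \<open>t\<close> makes the value equal to \<open>-1\<close>.\<close>
        using quadratic[of "(\<parallel>x\<parallel>\<^sup>2 + 1) / (2 * (cmod b)\<^sup>2)"] True by simp
    qed
    then show ?thesis by simp
  next
    case False
    then show ?thesis
      using quadratic[of "1 / \<parallel>y\<parallel>\<^sup>2"]
      by (simp add: field_simps power_mult_distrib)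
  qed
  then show ?thesis
    unfolding b_def by (rule power2_le_imp_le) simp
qed

lemma seminorm_le_norm:
  obtains C where "0 \<le> C" "\<And>x. \<parallel>x\<parallel> \<le> C * norm x"
proof -
  obtain K where K: "0 \<le> K" "\<And>x. norm (A x) \<le> norm x * K"
    using bounded_clinear bounded_linear.nonneg_bounded unfolding bounded_clinear_def by blast
  have "\<parallel>x\<parallel> \<le> sqrt K * norm x" for x
  proof (rule power2_le_imp_le)
    have "\<parallel>x\<parallel>\<^sup>2 = inner (A x) x"
      by (simp add: seminorm_power2 A_inner_def inner_eq_Re_cinner)
    also have "\<dots> \<le> norm (A x) * norm x" by (rule norm_cauchy_schwarz)
    also have "\<dots> \<le> norm x * K * norm x" by (intro mult_right_mono K) simp
    also have "\<dots> = (sqrt K * norm x)\<^sup>2"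
      using K(1) by (simp add: power_mult_distrib power2_eq_square)
    finally show "\<parallel>x\<parallel>\<^sup>2 \<le> (sqrt K * norm x)\<^sup>2" .
  qed (use K in simp)
  then show ?thesis using that[of "sqrt K"] K(1) by simp
qed

section \<open>Boundedness with respect to the seminorm\<close>

definition semi_bounded :: "('h \<Rightarrow> 'h) \<Rightarrow> bool"
  where "semi_bounded T \<longleftrightarrow> (\<exists>c. \<forall>x. \<parallel>T x\<parallel> \<le> c * \<parallel>x\<parallel>)"

text \<open>An operator bounded for the norm need not be bounded for the seminorm, but a symmetric one is
(Krein, Lax). By Cauchy--Schwarz the numbers \<open>a n = \<parallel>(S ^^ n) x\<parallel>\<close> are log-convex, so their successive
ratios never fall below the first one, \<open>r = a 1 / a 0\<close>. As \<open>S\<close> is bounded by \<open>M\<close> in norm, \<open>a n\<close> grows at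
most like \<open>M ^ n\<close>. Hence \<open>r \<le> M\<close>.\<close>

lemma symmetric_imp_semi_bounded:
  assumes S: "bounded_linear S" and sym: "\<And>x y. \<langle>S x | y\<rangle> = \<langle>x | S y\<rangle>"
  shows "semi_bounded S"
proof -
  obtain M where M: "0 < M" "\<And>x. norm (S x) \<le> norm x * M"
    using bounded_linear.pos_bounded[OF S] by blast
  obtain C where C: "0 \<le> C" "\<And>x. \<parallel>x\<parallel> \<le> C * norm x" using seminorm_le_norm by blast
  have "\<parallel>S x\<parallel> \<le> M * \<parallel>x\<parallel>" for x
  proof (rule ccontr)
    assume "\<not> ?thesis"
    then have big: "M * \<parallel>x\<parallel> < \<parallel>S x\<parallel>" by simp
    define a where "a n = \<parallel>(S ^^ n) x\<parallel>" for n
    have nonneg: "0 \<le> a n" for n by (simp add: a_def)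
    have convex: "(a (Suc n))\<^sup>2 \<le> a (Suc (Suc n)) * a n" for n
    proof -
      let ?y = "(S ^^ n) x"
      have "(a (Suc n))\<^sup>2 = Re \<langle>S (S ?y) | ?y\<rangle>" by (simp add: a_def seminorm_power2 sym)
      also have "\<dots> \<le> cmod \<langle>S (S ?y) | ?y\<rangle>" by (rule complex_Re_le_cmod)
      also have "\<dots> \<le> a (Suc (Suc n)) * a n"
        by (rule order_trans[OF semi_Cauchy_Schwarz]) (simp add: a_def)
      finally show ?thesis .
    qed
    have a1: "M * a 0 < a 1" using big by (simp add: a_def)
    have a0: "0 < a 0"
    proof (rule ccontr)
      assume "\<not> 0 < a 0"
      then have "a 0 = 0" using nonneg[of 0] by simp
      then show False using convex[of 0] a1 by simp
    qed
    define r where "r = a 1 / a 0"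
    have r: "M < r" using a1 a0 by (simp add: r_def field_simps)
    have step: "0 < a n \<and> r * a n \<le> a (Suc n)" for n
    proof (induction n)
      case 0
      then show ?case using a0 by (simp add: r_def)
    next
      case (Suc n)
      have pos: "0 < a (Suc n)"
        using Suc r M(1) by (meson less_le_trans less_trans mult_pos_pos)
      have "(r * a n) * a (Suc n) \<le> a (Suc n) * a (Suc n)"
        using Suc pos by (intro mult_right_mono) auto
      also have "\<dots> \<le> a (Suc (Suc n)) * a n" using convex[of n] by (simp add: power2_eq_square)
      finally have "(r * a (Suc n)) * a n \<le> a (Suc (Suc n)) * a n" by (simp add: mult_ac)
      then show ?case using Suc pos by simp
    qed
    have lower: "r ^ n * a 0 \<le> a n" for n
    proof (induction n)
      case (Suc n)
      have "r ^ Suc n * a 0 \<le> r * a n"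
        using Suc r M(1) by (simp add: mult.assoc)
      then show ?case using step[of n] by linarith
    qed simp
    have upper: "a n \<le> C * norm x * M ^ n" for n
    proof -
      have "norm ((S ^^ n) x) \<le> norm x * M ^ n"
      proof (induction n)
        case (Suc n)
        have "norm ((S ^^ Suc n) x) \<le> norm ((S ^^ n) x) * M" using M(2) by simp
        also have "\<dots> \<le> norm x * M ^ n * M" using Suc M(1) by (intro mult_right_mono) auto
        finally show ?case by (simp add: mult_ac)
      qed simp
      then have "C * norm ((S ^^ n) x) \<le> C * (norm x * M ^ n)" using C(1) by (rule mult_left_mono)
      then show ?thesis using C(2)[of "(S ^^ n) x"] by (simp add: a_def mult.assoc)
    qed
    obtain n where n: "C * norm x / a 0 < (r / M) ^ n"
      using real_arch_pow[of "r / M"] r M(1) by auto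
    then have "C * norm x * M ^ n < r ^ n * a 0"
      using a0 M(1) by (simp add: field_simps power_divide)
    then show False using lower[of n] upper[of n] by linarith
  qed
  then show ?thesis unfolding semi_bounded_def by blast
qed

text \<open>The product of \<open>X\<close> and \<open>T\<close> is symmetric, hence bounded for the seminorm, and it controls
\<open>\<parallel>T x\<parallel>\<^sup>2 = \<langle>X (T x) | x\<rangle>\<close>.\<close>

lemma semi_bounded_if_adjoint:
  assumes T: "bounded_clinear T" and X: "bounded_clinear X"
    and adj: "\<And>x y. \<langle>T x | y\<rangle> = \<langle>x | X y\<rangle>"
  shows "semi_bounded T"
proof -
  have adj': "\<langle>X x | y\<rangle> = \<langle>x | T y\<rangle>" for x y
    by (metis adj semi_inner_commute)
  have "semi_bounded (\<lambda>x. X (T x))"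
    by (rule symmetric_imp_semi_bounded)
      (use bounded_clinear_compose[OF X T] in \<open>auto simp: bounded_clinear_def adj adj'\<close>)
  then obtain c where c: "\<And>x. \<parallel>X (T x)\<parallel> \<le> c * \<parallel>x\<parallel>" by (auto simp: semi_bounded_def)
  have "\<parallel>T x\<parallel> \<le> sqrt \<bar>c\<bar> * \<parallel>x\<parallel>" for x
  proof (rule power2_le_imp_le)
    have "\<parallel>T x\<parallel>\<^sup>2 = Re \<langle>X (T x) | x\<rangle>" by (simp add: seminorm_power2 adj adj')
    also have "\<dots> \<le> \<parallel>X (T x)\<parallel> * \<parallel>x\<parallel>"
      by (rule order_trans[OF complex_Re_le_cmod semi_Cauchy_Schwarz])
    also have "\<dots> \<le> (\<bar>c\<bar> * \<parallel>x\<parallel>) * \<parallel>x\<parallel>"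
      by (intro mult_right_mono order_trans[OF c]) auto
    also have "\<dots> = (sqrt \<bar>c\<bar> * \<parallel>x\<parallel>)\<^sup>2" by (simp add: power_mult_distrib power2_eq_square)
    finally show "\<parallel>T x\<parallel>\<^sup>2 \<le> (sqrt \<bar>c\<bar> * \<parallel>x\<parallel>)\<^sup>2" .
  qed simp
  then show ?thesis unfolding semi_bounded_def by blast
qed

lemma exists_unit_vector:
  assumes "A \<noteq> (\<lambda>x. 0)"
  obtains x where "\<parallel>x\<parallel> = 1"
proof -
  obtain x0 where x0: "A x0 \<noteq> 0" using assms by auto
  have "\<parallel>x0\<parallel> \<noteq> 0"
  proof
    assume "\<parallel>x0\<parallel> = 0"
    then have "\<langle>x0 | A x0\<rangle> = 0" using semi_Cauchy_Schwarz[of x0 "A x0"] by simp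
    then have "inner (A x0) (A x0) = 0" by (simp add: A_inner_def inner_eq_Re_cinner)
    then show False using x0 by simp
  qed
  then have "\<parallel>complex_of_real (1 / \<parallel>x0\<parallel>) *\<^sub>C x0\<parallel> = 1" by (simp add: seminorm_scaleC norm_divide)
  then show ?thesis by (rule that)
qed

lemma semi_bounded_bdd_above:
  assumes "semi_bounded T"
  shows "bdd_above {\<parallel>T x\<parallel> |x. \<parallel>x\<parallel> = 1}"
proof -
  obtain c where "\<And>x. \<parallel>T x\<parallel> \<le> c * \<parallel>x\<parallel>" using assms by (auto simp: semi_bounded_def)
  then have "\<parallel>T x\<parallel> \<le> c" if "\<parallel>x\<parallel> = 1" for x using that by (metis mult.right_neutral)
  then show ?thesis by (auto intro: bdd_aboveI[of _ c])
qed

lemma A_opnorm_nonneg: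
  assumes "A \<noteq> (\<lambda>x. 0)" "semi_bounded T"
  shows "0 \<le> A_opnorm A T"
proof -
  obtain x where x: "\<parallel>x\<parallel> = 1" using exists_unit_vector[OF assms(1)] .
  have "0 \<le> \<parallel>T x\<parallel>" by simp
  also have "\<dots> \<le> A_opnorm A T"
    unfolding A_opnorm_def
    by (rule cSup_upper) (use x semi_bounded_bdd_above[OF assms(2)] in auto)
  finally show ?thesis .
qed

text \<open>The defining supremum only ranges over vectors of seminorm one. Vectors of positive seminorm are
rescaled; that \<open>T\<close> maps null vectors to null vectors is a consequence of its boundedness.\<close>

lemma seminorm_le_A_opnorm:
  assumes T: "bounded_clinear T" and bdd: "semi_bounded T"
  shows "\<parallel>T x\<parallel> \<le> A_opnorm A T * \<parallel>x\<parallel>"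
proof (cases "\<parallel>x\<parallel> = 0")
  case True
  with bdd have "\<parallel>T x\<parallel> \<le> 0" unfolding semi_bounded_def by (metis mult_zero_right)
  then show ?thesis using True by simp
next
  case False
  then have pos: "0 < \<parallel>x\<parallel>" using seminorm_nonneg[of x] by linarith
  define u where "u = complex_of_real (1 / \<parallel>x\<parallel>) *\<^sub>C x"
  have u: "\<parallel>u\<parallel> = 1" using pos by (simp add: u_def seminorm_scaleC norm_divide)
  have "\<parallel>T u\<parallel> \<le> A_opnorm A T"
    unfolding A_opnorm_def
    by (rule cSup_upper) (use u semi_bounded_bdd_above[OF bdd] in auto)
  also have "\<parallel>T u\<parallel> = \<parallel>T x\<parallel> / \<parallel>x\<parallel>"
    using pos by (simp add: u_def bounded_clinear_scaleC[OF T] seminorm_scaleC norm_divide)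
  finally show ?thesis using pos by (simp add: field_simps)
qed

end

section \<open>The adjoint with respect to the semi-inner product\<close>

text \<open>Projecting a solution \<open>X\<close> of \<open>A X = T\<^sup>* A\<close> onto the closure of the range of \<open>A\<close> gives another solution,
since the orthogonal complement of that range is the kernel of \<open>A\<close>. Two solutions with values in the
closure differ by a vector in the kernel and in the closure, which is zero. So the definite description
denotes an operator; of its properties only boundedness and the adjointness relation are kept.\<close>

lemma A_adjoint_works:
  fixes A :: "'h::complex_hilbert_space \<Rightarrow> 'h"
  assumes A: "positive_op A" and T: "T \<in> A_adjointable A"
  shows "bounded_clinear (A_adjoint A T)"
    and "A_inner A (T x) y = A_inner A x (A_adjoint A T y)"
proof -
  interpret positive_operator A by unfold_locales (rule A)
  let ?M = "closure (range A)"
  have T': "bounded_clinear T" using T by (simp add: A_adjointable_def)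
  obtain X where X: "bounded_clinear X" "A \<circ> X = cadjoint T \<circ> A"
    using T by (auto simp: A_adjointable_def)
  have sub: "subspace (range A)"
    using bounded_clinear by (auto simp: bounded_clinear_def
        intro!: linear_subspace_image bounded_linear.linear)
  have add: "x + y \<in> ?M" if "x \<in> ?M" "y \<in> ?M" for x y
  proof -
    obtain f g where fg: "\<forall>n. f n \<in> range A" "f \<longlonglongrightarrow> x" "\<forall>n. g n \<in> range A" "g \<longlonglongrightarrow> y"
      using \<open>x \<in> ?M\<close> \<open>y \<in> ?M\<close> unfolding closure_sequential by metis
    have "(\<lambda>n. f n + g n) \<longlonglongrightarrow> x + y" by (intro tendsto_add fg)
    moreover have "f n + g n \<in> range A" for n using fg(1,3) by (simp add: subspace_add[OF sub])
    ultimately show ?thesis unfolding closure_sequential by (intro exI[of _ "\<lambda>n. f n + g n"]) simp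
  qed
  have scale: "c *\<^sub>C x \<in> ?M" if "x \<in> ?M" for c x
  proof -
    obtain f where f: "\<forall>n. f n \<in> range A" "f \<longlonglongrightarrow> x"
      using \<open>x \<in> ?M\<close> unfolding closure_sequential by auto
    have "(\<lambda>n. c *\<^sub>C f n) \<longlonglongrightarrow> c *\<^sub>C x"
      by (rule bounded_linear.tendsto[OF bounded_linear_scaleC f(2)])
    moreover have "c *\<^sub>C f n \<in> range A" for n
      using f(1)[rule_format, of n] bounded_clinear_scaleC[OF bounded_clinear] by (metis image_iff rangeI)
    ultimately show ?thesis
      unfolding closure_sequential by (intro exI[of _ "\<lambda>n. c *\<^sub>C f n"]) simp
  qed
  have zero: "0 \<in> ?M" by (rule subsetD[OF closure_subset subspace_0[OF sub]])
  obtain P where "bounded_clinear P \<and> (\<forall>x. P x \<in> ?M)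
      \<and> (\<forall>x. \<forall>m\<in>?M. cinner (x - P x) m = 0)"
    using orthogonal_projection_exists[OF closed_closure zero add scale] by (rule exE)
  then have P: "bounded_clinear P" "\<And>x. P x \<in> ?M"
    "\<And>x m. m \<in> ?M \<Longrightarrow> cinner (x - P x) m = 0"
    by simp_all
  have AP: "A (P x) = A x" for x
  proof (rule cinner_left_cancel)
    fix y
    have "A y \<in> ?M" by (rule subsetD[OF closure_subset rangeI])
    then have "cinner (x - P x) (A y) = 0" by (rule P(3))
    then show "cinner (A (P x)) y = cinner (A x) y" by (simp add: self_adjoint cinner_diff_left)
  qed
  have "\<exists>!X. bounded_clinear X \<and> A \<circ> X = cadjoint T \<circ> A \<and> range X \<subseteq> ?M"
  proof (rule ex1I[of _ "\<lambda>x. P (X x)"])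
    have "A \<circ> (\<lambda>x. P (X x)) = A \<circ> X" by (simp add: fun_eq_iff AP)
    then show "bounded_clinear (\<lambda>x. P (X x)) \<and> A \<circ> (\<lambda>x. P (X x)) = cadjoint T \<circ> A
        \<and> range (\<lambda>x. P (X x)) \<subseteq> ?M"
      using bounded_clinear_compose[OF P(1) X(1)] X(2) P(2) by auto
  next
    fix Y assume Y: "bounded_clinear Y \<and> A \<circ> Y = cadjoint T \<circ> A \<and> range Y \<subseteq> ?M"
    show "Y = (\<lambda>x. P (X x))"
    proof
      fix x
      define e where "e = Y x - P (X x)"
      have "A (Y x) = A (X x)" using Y X(2) by (metis comp_apply)
      then have "A e = 0" by (simp add: e_def bounded_clinear_diff[OF bounded_clinear] AP)
      then have "cinner e (A y) = 0" for y using self_adjoint[of e y] by simp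
      then have "range A \<subseteq> {m. inner e m = 0}" by (auto simp: inner_eq_Re_cinner)
      then have "?M \<subseteq> {m. inner e m = 0}"
        by (rule closure_minimal) (rule closed_hyperplane)
      moreover have "Y x \<in> ?M" "P (X x) \<in> ?M" using Y P(2) by auto
      ultimately have "inner e (Y x) = 0" "inner e (P (X x)) = 0" by auto
      then have "inner e e = 0" by (simp add: e_def inner_diff_right)
      then show "Y x = P (X x)" by (simp add: e_def)
    qed
  qed
  from theI'[OF this, folded A_adjoint_def]
  have adj: "bounded_clinear (A_adjoint A T)" "A \<circ> A_adjoint A T = cadjoint T \<circ> A" by auto
  show "bounded_clinear (A_adjoint A T)" by (rule adj)
  have "A_inner A (T x) y = cinner x (cadjoint T (A y))"
    by (simp add: A_inner_def self_adjoint cadjoint_works[OF T'])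
  also have "cadjoint T (A y) = A (A_adjoint A T y)" using adj(2) by (metis comp_apply)
  finally show "A_inner A (T x) y = A_inner A x (A_adjoint A T y)"
    by (simp add: A_inner_def self_adjoint)
qed

section \<open>The bound for one row and for the matrix\<close>

text \<open>Put \<open>t = cos \<theta>\<close> and \<open>s = sin \<theta>\<close>, and \<open>p = t * q\<close>, \<open>w = t * r\<close>. Then
\<open>2 * (t * p + s * w) = q + (q * cos (2 * \<theta>) + r * sin (2 * \<theta>))\<close>, where the bracket is at most
\<open>sqrt (q\<^sup>2 + r\<^sup>2)\<close>. This is where the factor one half of the numerical radius bound comes from.\<close>

lemma double_angle_bound:
  fixes t s p w a \<kappa> :: real
  assumes t: "0 \<le> t" and ts: "t\<^sup>2 + s\<^sup>2 = 1" and p: "p \<le> a * t"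
    and pw: "p\<^sup>2 + w\<^sup>2 \<le> \<kappa> * t\<^sup>2" and a: "0 \<le> a" and \<kappa>: "0 \<le> \<kappa>"
  shows "t * p + s * w \<le> (a + sqrt \<kappa>) / 2"
proof (cases "t = 0")
  case True
  then have "p = 0" "w = 0" using pw by (simp_all add: sum_power2_le_zero_iff)
  then show ?thesis using a \<kappa> by simp
next
  case False
  define q r where "q = p / t" and "r = w / t"
  define u v where "u = 2 * t\<^sup>2 - 1" and "v = 2 * t * s"
  have pq: "p = t * q" and wr: "w = t * r" using False by (simp_all add: q_def r_def)
  have q: "q \<le> a" using p t False by (simp add: q_def field_simps)
  have "t\<^sup>2 * (q\<^sup>2 + r\<^sup>2) \<le> t\<^sup>2 * \<kappa>"
    using pw by (simp add: pq wr power_mult_distrib algebra_simps)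
  then have qr: "q\<^sup>2 + r\<^sup>2 \<le> \<kappa>" using False by simp
  have s2: "s\<^sup>2 = 1 - t\<^sup>2" using ts by simp
  have uv: "u\<^sup>2 + v\<^sup>2 = 1"
    unfolding u_def v_def power_mult_distrib s2 by (simp add: power2_eq_square algebra_simps)
  \<comment> \<open>\<open>(u, v)\<close> is the unit vector at the angle \<open>2 * \<theta>\<close>; next comes Cauchy--Schwarz in the plane.\<close>
  have "(u * q + v * r)\<^sup>2 \<le> (u * q + v * r)\<^sup>2 + (u * r - v * q)\<^sup>2" by simp
  also have "\<dots> = (u\<^sup>2 + v\<^sup>2) * (q\<^sup>2 + r\<^sup>2)" by (simp add: power2_eq_square algebra_simps)
  also have "\<dots> \<le> \<kappa>" using uv qr by simp
  finally have "u * q + v * r \<le> sqrt \<kappa>" by (rule real_le_rsqrt)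
  moreover have "2 * (t * p + s * w) = q + (u * q + v * r)"
    by (simp add: pq wr u_def v_def power2_eq_square algebra_simps)
  ultimately show ?thesis using q by simp
qed

context positive_operator
begin

text \<open>Moving all operators to the other side, \<open>\<langle>\<Sum>j\<in>J. R j (x j) | x i\<rangle> = (\<Sum>j\<in>J. \<langle>x j | z j\<rangle>)\<close> with
\<open>z j = R' j (x i)\<close>. The diagonal term is estimated separately from the others, which are combined by
Cauchy--Schwarz. The component \<open>x i\<close> has length \<open>t\<close> and the remaining ones have joint length
\<open>s = sqrt (1 - t\<^sup>2)\<close>. The diagonal entry bounds \<open>\<parallel>z i\<parallel>\<close>, the operator \<open>Q = (\<Sum>j\<in>J. R j R' j)\<close> bounds
\<open>(\<Sum>j\<in>J. \<parallel>z j\<parallel>\<^sup>2) = \<langle>Q (x i) | x i\<rangle>\<close>, and \<open>double_angle_bound\<close> combines the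
two estimates.\<close>

lemma row_numerical_radius_bound:
  fixes R R' :: "'i \<Rightarrow> 'h \<Rightarrow> 'h"
  assumes nonzero: "A \<noteq> (\<lambda>x. 0)" and J: "finite J" "i \<in> J"
    and R: "\<And>j. j \<in> J \<Longrightarrow> bounded_clinear (R j)"
    and R': "\<And>j. j \<in> J \<Longrightarrow> bounded_clinear (R' j)"
    and adj: "\<And>j x y. j \<in> J \<Longrightarrow> \<langle>R j x | y\<rangle> = \<langle>x | R' j y\<rangle>"
    and unit: "(\<Sum>j\<in>J. \<parallel>x j\<parallel>\<^sup>2) = 1"
  shows "cmod \<langle>\<Sum>j\<in>J. R j (x j) | x i\<rangle>
    \<le> (A_opnorm A (R i) + sqrt (A_opnorm A (\<lambda>y. \<Sum>j\<in>J. R j (R' j y)))) / 2"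
proof -
  define Q where "Q y = (\<Sum>j\<in>J. R j (R' j y))" for y
  have Q: "bounded_clinear Q"
    unfolding Q_def by (intro bounded_clinear_sum bounded_clinear_compose[OF R R'])
  have Qform: "\<langle>Q y | z\<rangle> = (\<Sum>j\<in>J. \<langle>R' j y | R' j z\<rangle>)" for y z
    by (simp add: Q_def semi_inner_sum_left adj)
  have Qbdd: "semi_bounded Q"
  proof (rule symmetric_imp_semi_bounded)
    show "bounded_linear Q" using Q by (simp add: bounded_clinear_def)
    show "\<langle>Q y | z\<rangle> = \<langle>y | Q z\<rangle>" for y z
      unfolding semi_inner_commute[of y "Q z"] Qform cnj_sum
      by (rule sum.cong[OF refl], rule semi_inner_commute)
  qed
  have Ri: "semi_bounded (R i)"
    using semi_bounded_if_adjoint[OF R R' adj] J by blast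
  define t where "t = \<parallel>x i\<parallel>"
  define z where "z j = R' j (x i)" for j
  define p where "p = \<parallel>z i\<parallel>"
  define s where "s = sqrt (\<Sum>j\<in>J - {i}. \<parallel>x j\<parallel>\<^sup>2)"
  define w where "w = sqrt (\<Sum>j\<in>J - {i}. \<parallel>z j\<parallel>\<^sup>2)"
  have s2: "s\<^sup>2 = (\<Sum>j\<in>J - {i}. \<parallel>x j\<parallel>\<^sup>2)" by (simp add: s_def sum_nonneg)
  have w2: "w\<^sup>2 = (\<Sum>j\<in>J - {i}. \<parallel>z j\<parallel>\<^sup>2)" by (simp add: w_def sum_nonneg)
  have ts: "t\<^sup>2 + s\<^sup>2 = 1"
    using unit by (simp add: s2 t_def sum.remove[OF J])
  have pw: "p\<^sup>2 + w\<^sup>2 \<le> A_opnorm A Q * t\<^sup>2"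
  proof -
    have "p\<^sup>2 + w\<^sup>2 = Re \<langle>Q (x i) | x i\<rangle>"
      by (simp add: Qform w2 p_def sum.remove[OF J] z_def seminorm_power2)
    also have "\<dots> \<le> \<parallel>Q (x i)\<parallel> * \<parallel>x i\<parallel>"
      by (rule order_trans[OF complex_Re_le_cmod semi_Cauchy_Schwarz])
    also have "\<dots> \<le> A_opnorm A Q * \<parallel>x i\<parallel> * \<parallel>x i\<parallel>"
      by (intro mult_right_mono seminorm_le_A_opnorm Q Qbdd) simp
    finally show ?thesis by (simp add: t_def power2_eq_square mult.assoc)
  qed
  \<comment> \<open>An operator and its adjoint have the same seminorm.\<close>
  have p: "p \<le> A_opnorm A (R i) * t"
  proof (cases "p = 0")
    case True
    then show ?thesis using A_opnorm_nonneg[OF nonzero Ri] by (simp add: t_def)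
  next
    case False
    then have pos: "0 < p" using seminorm_nonneg[of "z i"] unfolding p_def by linarith
    have "p * p = Re \<langle>R i (z i) | x i\<rangle>"
      using J by (simp add: p_def z_def adj flip: power2_eq_square seminorm_power2)
    also have "\<dots> \<le> \<parallel>R i (z i)\<parallel> * \<parallel>x i\<parallel>"
      by (rule order_trans[OF complex_Re_le_cmod semi_Cauchy_Schwarz])
    also have "\<dots> \<le> A_opnorm A (R i) * \<parallel>z i\<parallel> * \<parallel>x i\<parallel>"
      using J by (intro mult_right_mono seminorm_le_A_opnorm R Ri) simp_all
    finally have "p * p \<le> p * (A_opnorm A (R i) * t)" by (simp add: p_def t_def mult_ac)
    then show ?thesis using pos by simp
  qed
  have "cmod \<langle>\<Sum>j\<in>J. R j (x j) | x i\<rangle> = cmod (\<Sum>j\<in>J. \<langle>x j | z j\<rangle>)"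
    by (simp add: semi_inner_sum_left adj z_def)
  also have "\<dots> \<le> (\<Sum>j\<in>J. \<parallel>x j\<parallel> * \<parallel>z j\<parallel>)"
    by (rule sum_norm_le) (rule semi_Cauchy_Schwarz)
  also have "\<dots> = t * p + (\<Sum>j\<in>J - {i}. \<parallel>x j\<parallel> * \<parallel>z j\<parallel>)"
    by (simp add: sum.remove[OF J] t_def p_def)
  also have "(\<Sum>j\<in>J - {i}. \<parallel>x j\<parallel> * \<parallel>z j\<parallel>) \<le> s * w"
    using L2_set_mult_ineq[of "\<lambda>j. \<parallel>x j\<parallel>" "\<lambda>j. \<parallel>z j\<parallel>" "J - {i}"]
    by (simp add: L2_set_def s_def w_def)
  also have "t * p + s * w \<le> (A_opnorm A (R i) + sqrt (A_opnorm A Q)) / 2"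
    using ts p pw A_opnorm_nonneg[OF nonzero Ri] A_opnorm_nonneg[OF nonzero Qbdd]
    by (intro double_angle_bound) (simp_all add: t_def)
  finally show ?thesis by (simp add: Q_def[abs_def])
qed

end

lemma A_inner_diag_op:
  "A_inner (diag_op A) x y = (\<Sum>i\<in>UNIV. A_inner A (x $ i) (y $ i))"
proof -
  have "(if i = j then A else (\<lambda>x. 0)) v = (if i = j then A v else 0)" for i j :: 'b and v
    by simp
  then show ?thesis
    by (simp add: A_inner_def diag_op_def op_matrix_def cinner_vec_def)
qed

theorem theorem2p1:
  fixes A :: "'h::complex_hilbert_space \<Rightarrow> 'h"
    and T :: "'d::finite \<Rightarrow> 'd \<Rightarrow> 'h \<Rightarrow> 'h"
  assumes "positive_op A"
    and "A \<noteq> (\<lambda>x. 0)"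
    and "\<And>i j. T i j \<in> A_adjointable A"
  shows "A_numerical_radius (diag_op A) (op_matrix T)
    \<le> 1 / 2 * (\<Sum>i\<in>UNIV. A_opnorm A (T i i)
        + sqrt (A_opnorm A (\<lambda>x. T i i (A_adjoint A (T i i) x)
            + (\<Sum>j\<in>UNIV - {i}. T i j (A_adjoint A (T i j) x)))))"
proof -
  interpret positive_operator A by unfold_locales (rule assms(1))
  have T: "bounded_clinear (T i j)" for i j
    using assms(3) by (simp add: A_adjointable_def)
  note adjoint = A_adjoint_works[OF assms(1) assms(3)]
  have norm_eq: "A_norm (diag_op A) x = sqrt (\<Sum>i\<in>UNIV. \<parallel>x $ i\<parallel>\<^sup>2)" for x :: "'h ^ 'd"
    by (simp add: A_norm_def[of "diag_op A"] A_inner_diag_op seminorm_power2)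
  \<comment> \<open>The supremum of an empty set of reals is unspecified, so a unit vector is needed.\<close>
  have "\<exists>x :: 'h ^ 'd. A_norm (diag_op A) x = 1"
  proof -
    obtain u where u: "\<parallel>u\<parallel> = 1" using exists_unit_vector[OF assms(2)] .
    have zero: "\<parallel>0\<parallel> = 0" by (simp add: A_norm_def A_inner_def)
    fix k :: 'd
    have "\<parallel>(\<chi> i. if i = k then u else 0) $ i\<parallel>\<^sup>2 = (if i = k then 1 else 0)" for i
      by (simp add: u zero)
    then show ?thesis
      by (intro exI[of _ "\<chi> i. if i = k then u else 0"]) (simp add: norm_eq)
  qed
  then have ne: "{cmod (A_inner (diag_op A) (op_matrix T x) x) |x.
      A_norm (diag_op A) (x :: 'h ^ 'd) = 1} \<noteq> {}"
    by blast
  have full_row: "(\<lambda>x. T i i (A_adjoint A (T i i) x) + (\<Sum>j\<in>UNIV - {i}. T i j (A_adjoint A (T i j) x)))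
    = (\<lambda>x. \<Sum>j\<in>UNIV. T i j (A_adjoint A (T i j) x))" for i
    by (rule ext, rule sum.remove[symmetric]) simp_all
  show ?thesis
    unfolding A_numerical_radius_def full_row
  proof (rule cSup_least[OF ne])
    fix v assume "v \<in> {cmod (A_inner (diag_op A) (op_matrix T x) x) |x.
      A_norm (diag_op A) (x :: 'h ^ 'd) = 1}"
    then obtain x :: "'h ^ 'd" where v: "v = cmod (A_inner (diag_op A) (op_matrix T x) x)"
      and "A_norm (diag_op A) x = 1" by blast
    then have unit: "(\<Sum>i\<in>UNIV. \<parallel>x $ i\<parallel>\<^sup>2) = 1" by (simp add: norm_eq)
    have "v = cmod (\<Sum>i\<in>UNIV. \<langle>\<Sum>j\<in>UNIV. T i j (x $ j) | x $ i\<rangle>)"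
      by (simp add: v A_inner_diag_op op_matrix_def)
    also have "\<dots> \<le> (\<Sum>i\<in>UNIV. (A_opnorm A (T i i)
        + sqrt (A_opnorm A (\<lambda>y. \<Sum>j\<in>UNIV. T i j (A_adjoint A (T i j) y)))) / 2)"
      by (intro sum_norm_le row_numerical_radius_bound[where x = "\<lambda>j. x $ j"])
        (use assms(2) T adjoint unit in auto)
    finally show "v \<le> 1 / 2 * (\<Sum>i\<in>UNIV. A_opnorm A (T i i)
        + sqrt (A_opnorm A (\<lambda>x. \<Sum>j\<in>UNIV. T i j (A_adjoint A (T i j) x))))"
      by (simp add: sum_divide_distrib)
  qed
qed

end
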